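(* Consider the Energy Sharing Game $(N,v)$ with admission fees $c_i\ge 0$, $i\in U$, and let $v_0$ be the characteristic function of the corresponding game without fees. The following statements are equivalent: (i) $C(N,v)\ne\emptyset$; (ii) $(0,\dots,0,v(N))\in C(N,v)$ (every user gets $0$ and the aggregator gets $v(N)$); (iii) $v(S)\le v(N)$ for all $S\in\mathcal{P}^a$; (iv) $c(U)-c(S)=c(U\setminus S)\le v_0(N)-v_0(S)$ for all $S\in\mathcal{P}^a$.
   Context: Energy Sharing Game. The player set is $N=U\cup\{a\}$, where $U$ is a finite set of users with $|U|\ge 2$ and $a\notin U$ is the aggregator. Fix an integer $m\ge 1$. Each user $i\in U$ has: a compact set $D_i\subseteq\mathbb{R}^{n_i}\times\mathbb{R}^{2m}_+$, whose points are written $(z_i,y_i)$ with $y_i=[y_i^+,y_i^-]\in\mathbb{R}^m_+\times\mathbb{R}^m_+$, such that $D_i^z=\{z_i\in\mathbb{R}^{n_i}:(z_i,0)\in D_i\}$ is nonempty; a continuous function $f_i:\mathbb{R}^{n_i+2m}\to\mathbb{R}$; and an admission fee $c_i\ge 0$. There is also a continuous function $f_a:\mathbb{R}^m\to\mathbb{R}_+$ with $f_a(0)=0$. Put $b_i=\max\{f_i(z_i,0):z_i\in D_i^z\}$ and, for $S\subseteq N$ with $a\in S$ and $|S\cap U|\ge 2$, $$b_S=\max\Big\{\sum_{i\in S\cap U} [f_i(z_i,y_i)-c_i]+f_a\Big(\sum_{i\in S\cap U}y_i^+\Big):\ (z_i,y_i)\in D_i\ (i\in S\cap U),\ \sum_{i\in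 S\cap U}y_i^+=\sum_{i\in S\cap U}y_i^-\Big\}.$$ The characteristic function is $v(S)=b_S-\sum_{i\in S\cap U}b_i$ if $a\in S$ and $|S\cap U|\ge 2$, and $v(S)=0$ for every other $S\subseteq N$. $v_0$ denotes the characteristic function of the game with the same data but all admission fees replaced by $0$; thus $v(S)=v_0(S)-c(S)$ if $a\in S$ and $|S\cap U|\ge 2$, where $c(S)=\sum_{i\in S\cap U}c_i$. Notation: $\mathcal{P}=\{S\subseteq N:S\ne\emptyset,S\ne N\}$, $\mathcal{P}^a=\{S\in\mathcal{P}:a\in S\}$. An allocation is a vector $x\in\mathbb{R}^{|N|}$, ordered with the aggregator's component last; $x(S)=\sum_{i\in S}x_i$. The core is $C(N,v)=\{x\in\mathbb{R}^{|N|}:x(N)=v(N),\ x(S)\ge v(S)\ \forall S\in\mathcal{P}\}$. *)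

theory Defs
  imports "HOL-Analysis.Analysis"
begin

text \<open>
  Players are elements of an arbitrary type; the player set is \<open>insert a U\<close>.
  The number \<open>m \<ge> 1\<close> is the cardinality of the index type \<open>'m\<close>, whereas the dimensions \<open>n i\<close>
  depend on the user, so the space of the vectors \<open>z i\<close> is the library's
  \<open>Euclidean_space (n i)\<close>, whose points are the functions \<open>nat \<Rightarrow> real\<close> that vanish from
  index \<open>n i\<close> on. A decision of a user is a triple \<open>(z, yp, ym)\<close>, where \<open>yp\<close> and \<open>ym\<close> stand for
  \<open>y\<^sup>+\<close> and \<open>y\<^sup>-\<close>.
\<close>

type_synonym 'm decision = "(nat \<Rightarrow> real) \<times> ((real ^ 'm) \<times> (real ^ 'm))"

text \<open>\<open>Max\<close> is meaningful on finite sets only. If \<open>g ` A\<close> has no greatest element, then the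
  value below is unspecified; compactness and continuity exclude this case in the game.\<close>

definition maximum :: "('b \<Rightarrow> real) \<Rightarrow> 'b set \<Rightarrow> real" where
  "maximum g A = (GREATEST r. r \<in> g ` A)"

definition standalone_set :: "('m::finite) decision set \<Rightarrow> (nat \<Rightarrow> real) set" where
  "standalone_set Di = {z. (z, 0) \<in> Di}"

definition standalone_value ::
  "('m::finite) decision set \<Rightarrow> ('m decision \<Rightarrow> real) \<Rightarrow> real" where
  "standalone_value Di fi = maximum (\<lambda>z. fi (z, 0)) (standalone_set Di)"

definition feasible_profiles ::
  "('p \<Rightarrow> ('m::finite) decision set) \<Rightarrow> 'p set \<Rightarrow> ('p \<Rightarrow> 'm decision) set" where
  "feasible_profiles D T =
     {w \<in> (\<Pi>\<^sub>E i\<in>T. D i). (\<Sum>i\<in>T. fst (snd (w i))) = (\<Sum>i\<in>T. snd (snd (w i)))}"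

definition sharing_value ::
  "('p \<Rightarrow> ('m::finite) decision set) \<Rightarrow> ('p \<Rightarrow> 'm decision \<Rightarrow> real) \<Rightarrow> (real ^ 'm \<Rightarrow> real)
    \<Rightarrow> ('p \<Rightarrow> real) \<Rightarrow> 'p set \<Rightarrow> real" where
  "sharing_value D f fa c T =
     maximum (\<lambda>w. (\<Sum>i\<in>T. f i (w i) - c i) + fa (\<Sum>i\<in>T. fst (snd (w i))))
       (feasible_profiles D T)"

definition char_fun ::
  "'p set \<Rightarrow> 'p \<Rightarrow> ('p \<Rightarrow> ('m::finite) decision set) \<Rightarrow> ('p \<Rightarrow> 'm decision \<Rightarrow> real)
    \<Rightarrow> (real ^ 'm \<Rightarrow> real) \<Rightarrow> ('p \<Rightarrow> real) \<Rightarrow> 'p set \<Rightarrow> real" where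
  "char_fun U a D f fa c S =
     (if a \<in> S \<and> card (S \<inter> U) \<ge> 2
      then sharing_value D f fa c (S \<inter> U) - (\<Sum>i\<in>S \<inter> U. standalone_value (D i) (f i))
      else 0)"

definition total_fee :: "'p set \<Rightarrow> ('p \<Rightarrow> real) \<Rightarrow> 'p set \<Rightarrow> real" where
  "total_fee U c S = (\<Sum>i\<in>S \<inter> U. c i)"

definition proper_coalitions :: "'p set \<Rightarrow> 'p set set" where
  "proper_coalitions N = {S. S \<subseteq> N \<and> S \<noteq> {} \<and> S \<noteq> N}"

definition proper_coalitions_with :: "'p \<Rightarrow> 'p set \<Rightarrow> 'p set set" where
  "proper_coalitions_with a N = {S \<in> proper_coalitions N. a \<in> S}"

text \<open>Allocations are vectors indexed by the players themselves, i.e. extensional functions on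
  \<open>N\<close>, so no ordering of the components is needed.\<close>

definition core :: "'p set \<Rightarrow> ('p set \<Rightarrow> real) \<Rightarrow> ('p \<Rightarrow> real) set" where
  "core N v = {x \<in> N \<rightarrow>\<^sub>E UNIV. sum x N = v N \<and> (\<forall>S\<in>proper_coalitions N. sum x S \<ge> v S)}"

definition all_to :: "'p \<Rightarrow> 'p set \<Rightarrow> real \<Rightarrow> 'p \<Rightarrow> real" where
  "all_to a N r = (\<lambda>i\<in>N. if i = a then r else 0)"

locale energy_sharing_game =
  fixes U :: "'p set"
    and a :: 'p
    and n :: "'p \<Rightarrow> nat"
    and D :: "'p \<Rightarrow> ('m::finite) decision set"
    and f :: "'p \<Rightarrow> 'm decision \<Rightarrow> real"
    and fa :: "real ^ 'm \<Rightarrow> real"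
    and c :: "'p \<Rightarrow> real"
  assumes finite_users: "finite U"
    and two_users: "card U \<ge> 2"
    and aggregator: "a \<notin> U"
    and compact_decisions:
      "\<And>i. i \<in> U \<Longrightarrow> compactin (prod_topology (Euclidean_space (n i)) euclidean) (D i)"
    and nonneg_exchange:
      "\<And>i z yp ym k. i \<in> U \<Longrightarrow> (z, yp, ym) \<in> D i \<Longrightarrow> 0 \<le> yp $ k \<and> 0 \<le> ym $ k"
    and standalone_nonempty: "\<And>i. i \<in> U \<Longrightarrow> standalone_set (D i) \<noteq> {}"
    and continuous_utility:
      "\<And>i. i \<in> U \<Longrightarrow>
        continuous_map (prod_topology (Euclidean_space (n i)) euclidean) euclideanreal (f i)"
    and fee_nonneg: "\<And>i. i \<in> U \<Longrightarrow> 0 \<le> c i"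
    and continuous_aggregator: "continuous_on UNIV fa"
    and aggregator_nonneg: "\<And>y. 0 \<le> fa y"
    and aggregator_zero: "fa 0 = 0"

end

theory Submission
  imports Defs
begin

text \<open>
  A user alone is worth \<open>0\<close>, so every core allocation is nonnegative on the users and
  \<open>v S \<le> x S \<le> x N = v N\<close> whenever the aggregator is in \<open>S\<close>. Conversely, coalitions without the
  aggregator are worth \<open>0\<close>, so these inequalities are all that the allocation giving everything to
  the aggregator has to satisfy. The maxima exist by compactness, hence fees only shift
  \<open>v\<^sub>0\<close> by a constant; for coalitions with at most one user, where this shift fails, the
  inequalities of (iii) and (iv) follow from those for \<open>S = {a}\<close>, which both say
  \<open>c U \<le> v\<^sub>0 N\<close>.
\<close>

lemma maximum_eqI:
  assumes "w \<in> A" and "\<And>w'. w' \<in> A \<Longrightarrow> g w' \<le> g w"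
  shows "maximum g A = g w"
  unfolding maximum_def by (rule Greatest_equality) (use assms in auto)

text \<open>The attained maximum \<open>w\<close> is what makes the two sides comparable: without a
  greatest element, both would be unspecified values of \<open>GREATEST\<close>.\<close>

lemma maximum_shift:
  fixes g :: "'b \<Rightarrow> real"
  assumes "w \<in> A" and "\<And>w'. w' \<in> A \<Longrightarrow> g w' \<le> g w"
  shows "maximum (\<lambda>w. g w - k) A = maximum g A - k"
  using assms by (simp add: maximum_eqI[where w = w])

lemma compactin_attains_max:
  fixes g :: "'b \<Rightarrow> real"
  assumes "compactin X A" "A \<noteq> {}" "continuous_map X euclideanreal g"
  obtains w where "w \<in> A" "\<And>w'. w' \<in> A \<Longrightarrow> g w' \<le> g w"
proof -
  have "compact (g ` A)"
    using image_compactin[OF assms(1,3)] by simp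
  then obtain r where "r \<in> g ` A" "\<forall>s\<in>g ` A. s \<le> r"
    using compact_attains_sup[of "g ` A"] assms(2) by blast
  then show ?thesis using that by auto
qed

lemma sum_all_to:
  assumes "finite N" "S \<subseteq> N"
  shows "sum (all_to a N r) S = (if a \<in> S then r else 0)"
proof -
  have "sum (all_to a N r) S = (\<Sum>i\<in>S. if i = a then r else 0)"
    by (rule sum.cong) (use assms in \<open>auto simp: all_to_def\<close>)
  then show ?thesis using finite_subset[OF assms(2,1)] by simp
qed

lemma total_fee_diff:
  assumes "finite U"
  shows "total_fee U c U - total_fee U c S = total_fee U c (U - S)"
proof -
  \<comment> \<open>Coalitions may contain the aggregator, so \<open>sum_diff\<close> is applied to
    \<open>S \<inter> U\<close>, which is a subset of \<open>U\<close>.\<close>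
  have "(U - S) \<inter> U = U - (S \<inter> U)" by blast
  then show ?thesis
    using assms by (simp add: total_fee_def sum_diff)
qed

context energy_sharing_game
begin

abbreviation decision_space :: "'p \<Rightarrow> 'm decision topology" where
  "decision_space i \<equiv> prod_topology (Euclidean_space (n i)) euclidean"

text \<open>Serves twice: the balance constraint becomes a closed condition, and the aggregator's
  term becomes continuous in the profile.\<close>

lemma continuous_map_exchange:
  assumes "finite T"
  shows "continuous_map (product_topology decision_space T) euclidean
           (\<lambda>w. \<Sum>i\<in>T. fst (snd (w i)))"
    and "continuous_map (product_topology decision_space T) euclidean
           (\<lambda>w. \<Sum>i\<in>T. snd (snd (w i)))"
proof -
  have *: "continuous_map (product_topology decision_space T) euclidean (\<lambda>w. h (snd (w i)))"
    if "i \<in> T" "continuous_on UNIV h" for i and h :: "(real^'m) \<times> (real^'m) \<Rightarrow> real^'m"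
  proof -
    have "continuous_map (product_topology decision_space T) (decision_space i) (\<lambda>w. w i)"
      using that by (intro continuous_map_product_projection)
    then have "continuous_map (product_topology decision_space T) euclidean (\<lambda>w. snd (w i))"
      using continuous_map_compose[OF _ continuous_map_snd] by (fastforce simp: o_def)
    then show ?thesis
      using continuous_map_compose[of _ euclidean "\<lambda>w. snd (w i)" euclidean h] that
      by (simp add: o_def)
  qed
  show "continuous_map (product_topology decision_space T) euclidean
           (\<lambda>w. \<Sum>i\<in>T. fst (snd (w i)))"
    by (intro continuous_map_sum assms *) (auto intro: continuous_intros)
  show "continuous_map (product_topology decision_space T) euclidean
           (\<lambda>w. \<Sum>i\<in>T. snd (snd (w i)))"
    by (intro continuous_map_sum assms *) (auto intro: continuous_intros)
qed

text \<open>The product of the compact sets \<open>D i\<close> is compact by Tychonoff, and balance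
  cuts out a closed set, being an equation between continuous maps into a Hausdorff space.\<close>

lemma compactin_feasible_profiles:
  assumes "T \<subseteq> U"
  shows "compactin (product_topology decision_space T) (feasible_profiles D T)"
proof -
  let ?P = "product_topology decision_space T"
  have fin: "finite T" using assms finite_users finite_subset by blast
  have cmp: "compactin ?P (\<Pi>\<^sub>E i\<in>T. D i)"
    using assms compact_decisions by (auto simp: compactin_PiE)
  have "closedin ?P {w \<in> topspace ?P.
      (\<Sum>i\<in>T. fst (snd (w i))) = (\<Sum>i\<in>T. snd (snd (w i)))}" (is "closedin _ ?E")
    by (rule closedin_continuous_maps_eq[OF _ continuous_map_exchange[OF fin]]) simp
  from closed_Int_compactin[OF this cmp] show ?thesis
    using compactin_subset_topspace[OF cmp]
    by (elim back_subst[of "compactin ?P"]) (auto simp: feasible_profiles_def)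
qed

lemma feasible_profiles_nonempty:
  assumes "T \<subseteq> U"
  shows "feasible_profiles D T \<noteq> {}"
proof -
  have "\<forall>i\<in>T. \<exists>z. (z, 0) \<in> D i"
    using standalone_nonempty assms unfolding standalone_set_def by blast
  then obtain z where z: "\<And>i. i \<in> T \<Longrightarrow> (z i, 0) \<in> D i" by metis
  \<comment> \<open>Standalone decisions exchange nothing, so both sides of the balance equation are
    zero.\<close>
  then have "(\<lambda>i\<in>T. (z i, 0)) \<in> feasible_profiles D T"
    by (simp add: feasible_profiles_def)
  then show ?thesis by blast
qed

text \<open>For fixed \<open>T\<close> the fees lower the objective by the constant
  \<open>sum c T\<close> and leave the feasible set unchanged; compactness supplies the maximizer
  that \<open>maximum_shift\<close> requires.\<close>

lemma sharing_value_fees: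
  assumes "T \<subseteq> U"
  shows "sharing_value D f fa c T = sharing_value D f fa (\<lambda>_. 0) T - sum c T"
proof -
  let ?P = "product_topology decision_space T"
  let ?g = "\<lambda>w. (\<Sum>i\<in>T. f i (w i)) + fa (\<Sum>i\<in>T. fst (snd (w i)))"
  have fin: "finite T" using assms finite_users finite_subset by blast
  have "continuous_map ?P euclideanreal (\<lambda>w. f i (w i))" if "i \<in> T" for i
  proof -
    have "i \<in> U" using that assms by blast
    then show ?thesis
      using continuous_map_compose[OF continuous_map_product_projection[OF that]
          continuous_utility]
      by (simp add: o_def)
  qed
  moreover have "continuous_map ?P euclideanreal (\<lambda>w. fa (\<Sum>i\<in>T. fst (snd (w i))))"
    using continuous_map_compose[OF continuous_map_exchange(1)[OF fin], of euclideanreal fa]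
      continuous_aggregator by (simp add: o_def)
  ultimately have "continuous_map ?P euclideanreal ?g"
    by (intro continuous_map_add continuous_map_sum fin)
  then obtain w where "w \<in> feasible_profiles D T"
      "\<And>w'. w' \<in> feasible_profiles D T \<Longrightarrow> ?g w' \<le> ?g w"
    using compactin_attains_max[OF compactin_feasible_profiles feasible_profiles_nonempty] assms
    by blast
  from maximum_shift[of w _ ?g, OF this] show ?thesis
    by (simp add: sharing_value_def sum_subtractf algebra_simps)
qed

lemma char_fun_fees:
  assumes "a \<in> S" "card (S \<inter> U) \<ge> 2"
  shows "char_fun U a D f fa c S = char_fun U a D f fa (\<lambda>_. 0) S - total_fee U c S"
  using assms by (simp add: char_fun_def total_fee_def sharing_value_fees)

lemma core_imp_le_grand:
  assumes x: "x \<in> core (insert a U) (char_fun U a D f fa c)"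
    and S: "S \<in> proper_coalitions_with a (insert a U)"
  shows "char_fun U a D f fa c S \<le> char_fun U a D f fa c (insert a U)"
proof -
  let ?N = "insert a U" and ?v = "char_fun U a D f fa c"
  have x_ge: "?v T \<le> sum x T" if "T \<in> proper_coalitions ?N" for T
    using x that by (auto simp: core_def)
  have "0 \<le> x i" if "i \<in> U" for i
  proof -
    have "{i} \<in> proper_coalitions ?N" "a \<notin> {i}"
      using that aggregator by (auto simp: proper_coalitions_def)
    then show ?thesis using x_ge[of "{i}"] by (simp add: char_fun_def)
  qed
  \<comment> \<open>The players outside \<open>S\<close> are all users, since
    \<open>a \<in> S\<close>, so enlarging \<open>S\<close> to \<open>?N\<close> adds only
    nonnegative terms.\<close>
  then have "sum x S \<le> sum x ?N"
    using S finite_users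
    by (intro sum_mono2) (auto simp: proper_coalitions_with_def proper_coalitions_def)
  moreover have "?v S \<le> sum x S"
    using S x_ge by (simp add: proper_coalitions_with_def)
  moreover have "sum x ?N = ?v ?N"
    using x by (simp add: core_def)
  ultimately show ?thesis by simp
qed

lemma all_to_in_core:
  assumes "\<forall>S\<in>proper_coalitions_with a (insert a U).
      char_fun U a D f fa c S \<le> char_fun U a D f fa c (insert a U)"
  shows "all_to a (insert a U) (char_fun U a D f fa c (insert a U))
      \<in> core (insert a U) (char_fun U a D f fa c)"
proof -
  let ?N = "insert a U" and ?v = "char_fun U a D f fa c"
  have "?v S \<le> sum (all_to a ?N (?v ?N)) S" if "S \<in> proper_coalitions ?N" for S
  proof -
    have "S \<subseteq> ?N" using that by (simp add: proper_coalitions_def)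
    then show ?thesis
      using assms that finite_users
      \<comment> \<open>The first call settles the case \<open>a \<in> S\<close> by the assumption;
        otherwise the sum is 0, and unfolding \<open>char_fun\<close> shows that \<open>S\<close> is
        worth 0 too.\<close>
      by (simp add: sum_all_to proper_coalitions_with_def) (simp add: char_fun_def)
  qed
  moreover have "all_to a ?N (?v ?N) \<in> ?N \<rightarrow>\<^sub>E UNIV"
    by (auto simp: all_to_def)
  ultimately show ?thesis
    using finite_users by (simp add: core_def sum_all_to)
qed

lemma le_grand_iff_fees:
  "(\<forall>S\<in>proper_coalitions_with a (insert a U).
      char_fun U a D f fa c S \<le> char_fun U a D f fa c (insert a U)) \<longleftrightarrow>
   (\<forall>S\<in>proper_coalitions_with a (insert a U).
      total_fee U c (U - S)
        \<le> char_fun U a D f fa (\<lambda>_. 0) (insert a U) - char_fun U a D f fa (\<lambda>_. 0) S)"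
  (is "(\<forall>S\<in>?P. ?v S \<le> ?v ?N) \<longleftrightarrow> (\<forall>S\<in>?P. _ \<le> ?w ?N - ?w S)")
proof -
  have NU: "?N \<inter> U = U" by blast
  have grand: "?v ?N = ?w ?N - total_fee U c U"
    using char_fun_fees[of ?N] two_users by (simp add: NU total_fee_def)
  have diff: "total_fee U c (U - S) = total_fee U c U - total_fee U c S" for S
    using total_fee_diff[OF finite_users] by simp
  have fee: "0 \<le> total_fee U c S" for S
    using fee_nonneg by (auto simp: total_fee_def intro: sum_nonneg)
  have a: "a \<in> S" if "S \<in> ?P" for S
    using that by (simp add: proper_coalitions_with_def)
  have small: "?v S = 0" "?w S = 0" if "\<not> card (S \<inter> U) \<ge> 2" for S
    using that by (auto simp: char_fun_def)
  have "U \<noteq> {}" using two_users by auto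
  then have single: "{a} \<in> ?P"
    using aggregator by (auto simp: proper_coalitions_with_def proper_coalitions_def)
  have inter: "{a} \<inter> U = {}" using aggregator by blast
  have at_single: "total_fee U c {a} = 0" "?w {a} = 0"
    by (simp_all add: total_fee_def char_fun_def inter)
  show ?thesis
  proof (intro iffI ballI)
    fix S assume le: "\<forall>S\<in>?P. ?v S \<le> ?v ?N" and S: "S \<in> ?P"
    \<comment> \<open>With fewer than two users in \<open>S\<close>, the hypothesis reads
      \<open>total_fee U c U \<le> ?w ?N\<close>, and nonnegative fees give
      \<open>total_fee U c (U - S) \<le> total_fee U c U\<close>.\<close>
    show "total_fee U c (U - S) \<le> ?w ?N - ?w S"
      using bspec[OF le S] grand diff[of S] fee[of S] small[of S] char_fun_fees[OF a[OF S]]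
      by (cases "card (S \<inter> U) \<ge> 2") auto
  next
    fix S assume le: "\<forall>S\<in>?P. total_fee U c (U - S) \<le> ?w ?N - ?w S" and S: "S \<in> ?P"
    \<comment> \<open>With fewer than two users in \<open>S\<close>, the inequality for
      \<open>S\<close> itself falls short by \<open>total_fee U c S\<close>; the one for
      \<open>{a}\<close> gives the full bound \<open>total_fee U c U \<le> ?w ?N\<close>.\<close>
    show "?v S \<le> ?v ?N"
      using bspec[OF le S] bspec[OF le single] grand diff[of S] diff[of "{a}"] at_single
        small[of S] char_fun_fees[OF a[OF S]]
      by (cases "card (S \<inter> U) \<ge> 2") auto
  qed
qed

end

theorem theorem4:
  fixes U :: "'p set" and a :: 'p and n :: "'p \<Rightarrow> nat"
    and D :: "'p \<Rightarrow> ('m::finite) decision set"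
    and f :: "'p \<Rightarrow> 'm decision \<Rightarrow> real"
    and fa :: "real ^ 'm \<Rightarrow> real"
    and c :: "'p \<Rightarrow> real"
    and N :: "'p set" and v v\<^sub>0 :: "'p set \<Rightarrow> real"
  assumes game: "energy_sharing_game U a n D f fa c"
  defines "N \<equiv> insert a U"
    and "v \<equiv> char_fun U a D f fa c"
    and "v\<^sub>0 \<equiv> char_fun U a D f fa (\<lambda>_. 0)"
  shows "(core N v \<noteq> {} \<longleftrightarrow> all_to a N (v N) \<in> core N v)
    \<and> (all_to a N (v N) \<in> core N v \<longleftrightarrow> (\<forall>S\<in>proper_coalitions_with a N. v S \<le> v N))
    \<and> ((\<forall>S\<in>proper_coalitions_with a N. v S \<le> v N) \<longleftrightarrow>
        (\<forall>S\<in>proper_coalitions_with a N.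
           total_fee U c U - total_fee U c S = total_fee U c (U - S)
           \<and> total_fee U c (U - S) \<le> v\<^sub>0 N - v\<^sub>0 S))"
proof -
  interpret energy_sharing_game U a n D f fa c by (rule game)
  have "total_fee U c U - total_fee U c S = total_fee U c (U - S)" for S
    by (rule total_fee_diff[OF finite_users])
  then show ?thesis
    using core_imp_le_grand all_to_in_core le_grand_iff_fees
    unfolding N_def v_def v\<^sub>0_def by blast
qed

end
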